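(* Let $q$ be a prime power and let $f(x)\in\mathbb{F}_q[x]$ be a Costas polynomial. Then the family of $q\times q$ squares $\mathcal{L}^d$, $d\in\mathbb{F}_q\setminus\{1\}$, with rows and columns indexed by $\mathbb{F}_q$ and entries $$\mathcal{L}^d_{i,j}=i+f(dj)-f(j),\qquad i,j\in\mathbb{F}_q,$$ is a complete family of pairwise mutually orthogonal Latin squares of order $q$.
   Context: A permutation polynomial over $\mathbb{F}_q$ is a polynomial inducing a bijection of $\mathbb{F}_q$. A Costas polynomial over $\mathbb{F}_q$ is a polynomial $f\in\mathbb{F}_q[x]$ with $f(0)=0$ such that $f(dx)-f(x)$ is a permutation polynomial for every $d\in\mathbb{F}_q$, $d\neq 1$. A Latin square of order $m$ on a set $S$ with $|S|=m$ is an $m\times m$ table with entries in $S$ such that in each row and in each column the entries are distinct. Two Latin squares $\mathcal{L},\mathcal{K}$ of the same order are mutually orthogonal if the ordered pairs $(\mathcal{L}_{i,j},\mathcal{K}_{i,j})$ are distinct over all index pairs $(i,j)$. The maximum number of pairwise mutually orthogonal Latin squares of order $m$ is at most $m-1$, and a family of pairwise mutually orthogonal Latin squares of order $m$ is complete if it consists of $m-1$ squares. *)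

theory Defs
  imports "HOL-Computational_Algebra.Polynomial"
begin

definition permutation_poly :: "'a::{field,finite} poly \<Rightarrow> bool" where
  "permutation_poly p \<longleftrightarrow> bij (poly p)"

text \<open>The polynomial \<open>pcompose f [:0, d:]\<close> is $f(dx)$. The value \<open>d = 0\<close> is not excluded.\<close>

definition costas_poly :: "'a::{field,finite} poly \<Rightarrow> bool" where
  "costas_poly f \<longleftrightarrow>
     poly f 0 = 0 \<and> (\<forall>d. d \<noteq> 1 \<longrightarrow> permutation_poly (pcompose f [:0, d:] - f))"

text \<open>A square is a function of the row and the column index, with rows indexed by \<open>R\<close> and
  columns by \<open>C\<close>; only its values on \<open>R \<times> C\<close> matter. The finiteness conditions exclude infinite
  sets, for which \<open>card\<close> is \<open>0\<close>.\<close>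

definition latin_square ::
  "nat \<Rightarrow> 'r set \<Rightarrow> 'c set \<Rightarrow> 's set \<Rightarrow> ('r \<Rightarrow> 'c \<Rightarrow> 's) \<Rightarrow> bool" where
  "latin_square m R C S L \<longleftrightarrow>
     finite R \<and> card R = m \<and> finite C \<and> card C = m \<and> finite S \<and> card S = m \<and>
     (\<forall>i\<in>R. \<forall>j\<in>C. L i j \<in> S) \<and>
     (\<forall>i\<in>R. inj_on (\<lambda>j. L i j) C) \<and>
     (\<forall>j\<in>C. inj_on (\<lambda>i. L i j) R)"

definition orthogonal_squares ::
  "'r set \<Rightarrow> 'c set \<Rightarrow> ('r \<Rightarrow> 'c \<Rightarrow> 's) \<Rightarrow> ('r \<Rightarrow> 'c \<Rightarrow> 't) \<Rightarrow> bool" where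
  "orthogonal_squares R C L K \<longleftrightarrow> inj_on (\<lambda>(i, j). (L i j, K i j)) (R \<times> C)"

text \<open>Families are indexed by a set \<open>D\<close>, and members with distinct indices have to be orthogonal.
  For \<open>m \<ge> 2\<close> a square is not orthogonal to itself, so the members are then distinct and
  \<open>card D\<close> is the number of squares.\<close>

definition mols_family ::
  "nat \<Rightarrow> 'r set \<Rightarrow> 'c set \<Rightarrow> 's set \<Rightarrow> 'd set \<Rightarrow> ('d \<Rightarrow> 'r \<Rightarrow> 'c \<Rightarrow> 's) \<Rightarrow> bool" where
  "mols_family m R C S D L \<longleftrightarrow>
     (\<forall>d\<in>D. latin_square m R C S (L d)) \<and>
     pairwise (\<lambda>d e. orthogonal_squares R C (L d) (L e)) D"

definition complete_mols_family ::
  "nat \<Rightarrow> 'r set \<Rightarrow> 'c set \<Rightarrow> 's set \<Rightarrow> 'd set \<Rightarrow> ('d \<Rightarrow> 'r \<Rightarrow> 'c \<Rightarrow> 's) \<Rightarrow> bool" where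
  "complete_mols_family m R C S D L \<longleftrightarrow>
     mols_family m R C S D L \<and> finite D \<and> card D = m - 1"

end

theory Submission
  imports Defs
begin

text \<open>Subtracting the entries of two squares \<open>d \<noteq> e\<close> eliminates the row index and leaves
  $f(dj) - f(ej)$. If $e \neq 0$, the substitution $y = ej$ turns this into $f((d/e)y) - f(y)$ with
  $d/e \neq 1$, which is injective by the Costas property; if $e = 0$, exchange \<open>d\<close> and \<open>e\<close>.\<close>

lemma costas_poly_inj:
  assumes "costas_poly f" "d \<noteq> 1"
  shows "inj (\<lambda>x. poly f (d * x) - poly f x)"
proof -
  have "inj (poly (pcompose f [:0, d:] - f))"
    using assms unfolding costas_poly_def permutation_poly_def by (blast dest: bij_is_inj)
  moreover have "poly (pcompose f [:0, d:] - f) = (\<lambda>x. poly f (d * x) - poly f x)"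
    by (simp add: fun_eq_iff poly_pcompose mult.commute)
  ultimately show ?thesis by simp
qed

lemma costas_poly_diff_inj_nonzero:
  assumes "costas_poly f" "d \<noteq> e" "e \<noteq> 0"
  shows "inj (\<lambda>x. poly f (d * x) - poly f (e * x))"
proof -
  have "inj ((\<lambda>y. poly f (d / e * y) - poly f y) \<circ> (\<lambda>x. e * x))"
    using assms by (intro inj_compose costas_poly_inj) (auto intro: injI)
  then show ?thesis
    using \<open>e \<noteq> 0\<close> by (simp add: comp_def)
qed

lemma costas_poly_diff_inj:
  assumes "costas_poly f" "d \<noteq> e"
  shows "inj (\<lambda>x. poly f (d * x) - poly f (e * x))"
proof (cases "e = 0")
  case False
  then show ?thesis using assms by (rule costas_poly_diff_inj_nonzero[rotated 2])
next
  case True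
  \<comment> \<open>After the exchange the divisor is \<open>d\<close>, nonzero because it differs
    from \<open>e = 0\<close>. The quotient \<open>e / d\<close> is 0, so this case rests on the
    Costas property at 0.\<close>
  then have "inj (\<lambda>x. poly f (e * x) - poly f (d * x))"
    using assms by (intro costas_poly_diff_inj_nonzero) auto
  then have "inj (\<lambda>x. - (poly f (e * x) - poly f (d * x)))"
    unfolding inj_def neg_equal_iff_equal .
  then show ?thesis by simp
qed

text \<open>Each column is a translation in \<open>i\<close>. Each row is a translate of the
  difference map of \<open>f\<close> at \<open>d\<close>, which is injective by the Costas
  property.\<close>

lemma costas_poly_latin_square:
  fixes f :: "'a::{field,finite} poly"
  assumes "costas_poly f" "d \<noteq> 1"
  shows "latin_square (card (UNIV :: 'a set)) UNIV UNIV UNIV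
           (\<lambda>i j. i + poly f (d * j) - poly f j)"
proof -
  have "inj (\<lambda>j. i + poly f (d * j) - poly f j)" for i
  proof (rule injI)
    fix j j' assume "i + poly f (d * j) - poly f j = i + poly f (d * j') - poly f j'"
    then have "poly f (d * j) - poly f j = poly f (d * j') - poly f j'"
      unfolding add_diff_eq[symmetric] by (rule add_left_imp_eq)
    with costas_poly_inj[OF assms] show "j = j'" by (rule injD)
  qed
  then show ?thesis
    unfolding latin_square_def by (auto intro!: injI)
qed

lemma costas_poly_orthogonal_squares:
  assumes "costas_poly f" "d \<noteq> e"
  shows "orthogonal_squares UNIV UNIV
           (\<lambda>i j. i + poly f (d * j) - poly f j) (\<lambda>i j. i + poly f (e * j) - poly f j)"
  unfolding orthogonal_squares_def
proof (rule inj_onI, clarsimp)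
  fix i j i' j'
  assume eq_d: "i + poly f (d * j) - poly f j = i' + poly f (d * j') - poly f j'"
    and eq_e: "i + poly f (e * j) - poly f j = i' + poly f (e * j') - poly f j'"
  \<comment> \<open>Both \<open>i\<close> and the term \<open>poly f j\<close> occur in each entry,
    so they cancel in the difference, and likewise for the primed indices.\<close>
  have "poly f (d * j) - poly f (e * j) = poly f (d * j') - poly f (e * j')"
    using arg_cong2[OF eq_d eq_e, of "(-)"] by simp
  with costas_poly_diff_inj[OF assms] have "j = j'"
    by (rule injD)
  with eq_d show "i = i' \<and> j = j'" by simp
qed

theorem theorem5p1:
  fixes f :: "'a::{field,finite} poly" and q :: nat
  assumes "card (UNIV :: 'a set) = q" and "costas_poly f"
  shows "complete_mols_family q (UNIV :: 'a set) (UNIV :: 'a set) (UNIV :: 'a set) (UNIV - {1 :: 'a})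
           (\<lambda>d i j. i + poly f (d * j) - poly f j)"
  using assms costas_poly_latin_square[of f] costas_poly_orthogonal_squares[of f]
  \<comment> \<open>Removing the index 1 from the \<open>q\<close> field elements leaves the
    \<open>q - 1\<close> squares that completeness demands.\<close>
  by (auto simp: complete_mols_family_def mols_family_def pairwise_def card_Diff_singleton)

end
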